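(* There exist polynomials $P_0(z),P_1(z),P_2(z),\dots$ with $\deg P_{n-1}\le n$ for every $n\ge1$ such that for each integer $N\ge0$ \[ \frac{\operatorname{ali}(e^x)}{x e^x}=1+\sum_{n=1}^N\frac{P_{n-1}(\log x)}{x^n}+O\Bigl(\frac{\log^{N+1}x}{x^{N+1}}\Bigr),\qquad (x\to+\infty), \] where for $N=0$ the sum is understood to be $0$.
   Context: For real $x>1$, $\operatorname{li}(x)=\mathrm{p.v.}\int_0^x\frac{dt}{\log t}$; $\operatorname{li}$ is a strictly increasing bijection from $(1,+\infty)$ onto $\mathbb{R}$, and $\operatorname{ali}\colon\mathbb{R}\to(1,+\infty)$ denotes its inverse function, i.e. $\operatorname{li}(\operatorname{ali}(x))=x$. *)

theory Defs
  imports "HOL-Analysis.Analysis" "HOL-Library.Landau_Symbols"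
    "HOL-Computational_Algebra.Polynomial"
begin

text \<open>Logarithmic integral for x > 1, as a Cauchy principal value at t = 1.\<close>
definition li :: "real \<Rightarrow> real" where
  "li x = Lim (at_right 0)
     (\<lambda>e. integral {0..1 - e} (\<lambda>t. 1 / ln t) + integral {1 + e..x} (\<lambda>t. 1 / ln t))"

definition ali :: "real \<Rightarrow> real" where
  "ali y = (THE x. 1 < x \<and> li x = y)"

end

theory Submission
  imports Defs "HOL-Real_Asymp.Real_Asymp"
begin

text \<open>
  Write u for the logarithm of ali (exp x), and A(u) = li (exp u) u / exp u, which has the asymptotic
  series given by the sum of k! / u^k. The equation li (exp u) = exp x says that
  w = u - x - ln x satisfies w = ln (u / x) - ln A(u), where u / x = 1 + ln x / x + w / x.
  Starting from w = O(1), each use of this fixed point equation improves an expansion of w in powers of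
  ln x / x and 1 / x by one order. Finally ali (exp x) / (x exp x) = (u / x) / A(u), and
  uniqueness of the coefficients shows that the expansions of different orders are compatible.
\<close>

section \<open>The logarithmic integral and its inverse\<close>

text \<open>The series with coefficients k! diverges, so A is only accessible through finite
  truncations with an error bound, and substitution into it has to work from such truncations alone.
  The convergent series of ln (1 + z) and 1 / (1 + z) are brought into the same form by bounding
  their remainders. Every expansion carries the error (ln x / x)^M together with the bound n on the
  degree of the coefficient of 1 / x^n. This grading survives sums, products and substitution and is
  exactly the degree bound claimed, so no coefficient is ever computed. The principal value matters
  only for giving \<open>li\<close> a meaning: from \<open>has_real_derivative_li\<close> on, the
  derivative 1 / ln is all that is used.\<close>

lemma continuous_on_inverse_ln: "continuous_on {1<..} (\<lambda>t::real. 1 / ln t)"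
  by (intro continuous_intros) auto

lemma integrable_inverse_ln:
  fixes a b :: real
  assumes "1 < a"
  shows "(\<lambda>t. 1 / ln t) integrable_on {a..b}"
  using assms
  by (intro integrable_continuous_real continuous_on_subset[OF continuous_on_inverse_ln]) auto

text \<open>With t = 1 + s the two terms are 1/s + 1/2 + O(s) and -1/s + 1/2 + O(s): the poles
  cancel and the halves add up to 1.\<close>

lemma inverse_ln_symmetric_tendsto:
  "((\<lambda>t::real. 1 / ln t + 1 / ln (2 - t)) \<longlongrightarrow> 1) (at_right 1)"
  by real_asymp

text \<open>Continuity at 0 relies on the convention ln 0 = 0 together with 1 / 0 = 0.\<close>
lemma continuous_on_inverse_ln_at_zero:
  assumes "b < 1"
  shows "continuous_on {0..b} (\<lambda>t::real. 1 / ln t)"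
proof -
  have "continuous (at t within {0..b}) (\<lambda>t::real. 1 / ln t)" if t: "t \<in> {0..b}" for t
  proof (cases "t = 0")
    case True
    have "((\<lambda>t::real. 1 / ln t) \<longlongrightarrow> 0) (at_right 0)"
      by real_asymp
    then have "((\<lambda>t::real. 1 / ln t) \<longlongrightarrow> 0) (at 0 within {0..b})"
      by (rule tendsto_mono[rotated]) (unfold at_within_def, rule inf_mono, auto)
    then show ?thesis
      using True by (simp add: continuous_within)
  next
    case False
    then show ?thesis
      using t assms by (intro continuous_intros) auto
  qed
  then show ?thesis
    by (simp add: continuous_on_eq_continuous_within)
qed

text \<open>Reflecting the left half at t = 1 cancels the two singular parts.\<close>
lemma li_principal_value_converges_2:
  "\<exists>l. ((\<lambda>e. integral {0..1 - e} (\<lambda>t. 1 / ln t) + integral {1 + e..2} (\<lambda>t. 1 / ln t))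
      \<longlongrightarrow> (l::real)) (at_right 0)"
proof -
  define g :: "real \<Rightarrow> real" where "g = (\<lambda>t. if t = 1 then 1 else 1 / ln t + 1 / ln (2 - t))"
  have refl: "integral {0..1 - e} (\<lambda>t. 1 / ln t) = integral {1 + e..2} (\<lambda>t. 1 / ln (2 - t))"
    for e :: real
  proof -
    have "integral {0..1 - e} (\<lambda>t. 1 / ln t) = integral {-(1 - e)..-0} (\<lambda>t. 1 / ln (-t))"
      by (rule Henstock_Kurzweil_Integration.integral_reflect_real[symmetric])
    also have "\<dots> = integral {(1 + e) - 2..2 - 2} (\<lambda>t. 1 / ln (2 - (t + 2)))"
      by simp
    also have "\<dots> = integral {1 + e..2} (\<lambda>t. 1 / ln (2 - t))"
      by (rule integral_shift_real_ivl)
    finally show ?thesis .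
  qed
  have cont2: "continuous_on {1 + e..2} (\<lambda>t. 1 / ln (2 - t))" if "e > 0" for e :: real
    \<comment> \<open>At t = 2 the argument 2 - t reaches 0, so continuity up to the endpoint 0 is
      required here.\<close>
    by (rule continuous_on_compose2[OF continuous_on_inverse_ln_at_zero[of "1 - e"]])
      (use that in \<open>auto intro!: continuous_intros\<close>)
  have cont1: "continuous_on {1 + e..2} (\<lambda>t::real. 1 / ln t)" if "e > 0" for e :: real
    using that by (intro continuous_on_subset[OF continuous_on_inverse_ln]) auto
  have contg: "continuous_on {1 + e..2} g" if "e > 0" for e :: real
  proof -
    have "continuous_on {1 + e..2} (\<lambda>t. 1 / ln t + 1 / ln (2 - t))"
      by (intro continuous_on_add cont1 cont2 that)
    then show ?thesis
      by (rule continuous_on_cong[THEN iffD1, rotated 2]) (use that in \<open>auto simp: g_def\<close>)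
  qed
  have "continuous_on {1..2} g"
  proof -
    have "continuous (at t within {1..2}) g" if t: "t \<in> {1..2}" for t
    proof (cases "t = 1")
      case True
      have "(g \<longlongrightarrow> 1) (at_right 1)"
        by (rule Lim_transform_eventually[OF inverse_ln_symmetric_tendsto])
          (auto simp: g_def eventually_at_filter)
      then show ?thesis
        using True by (simp add: continuous_within g_def at_within_Icc_at_right)
    next
      case False
      \<comment> \<open>Half the distance to 1, so that {1 + e..2} is a neighbourhood of t relative
        to {1..2}.\<close>
      define e where "e = (t - 1) / 2"
      have e: "e > 0" "1 + e < t" using False t by (auto simp: e_def field_simps)
      have "continuous (at t within {1 + e..2}) g"
        using contg[OF e(1)] e t by (simp add: continuous_on_eq_continuous_within)
      moreover have "at t within {1 + e..2} = at t within {1..2}"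
        by (rule at_within_nhd[of _ "{1 + e<..}"]) (use e in auto)
      ultimately show ?thesis by (simp add: continuous_within)
    qed
    then show ?thesis
      by (simp add: continuous_on_eq_continuous_within)
  qed
  then have "continuous_on {1..2} (\<lambda>x. integral {x..2} g)"
    by (intro indefinite_integral_continuous_1' integrable_continuous_real)
  then have "((\<lambda>x. integral {x..2} g) \<longlongrightarrow> integral {1..2} g) (at_right 1)"
    by (auto simp: continuous_on_def at_within_Icc_at_right[of 1 2, symmetric])
  then have "((\<lambda>e. integral {1 + e..2} g) \<longlongrightarrow> integral {1..2} g) (at_right 0)"
    by (simp add: at_right_to_0[of 1] filterlim_filtermap add.commute)
  moreover have "eventually (\<lambda>e. integral {1 + e..2} g =
      integral {0..1 - e} (\<lambda>t. 1 / ln t) + integral {1 + e..2} (\<lambda>t. 1 / ln t)) (at_right (0::real))"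
    using eventually_at_right_less[of 0]
  proof eventually_elim
    case (elim e)
    have "integral {1 + e..2} g = integral {1 + e..2} (\<lambda>t. 1 / ln t + 1 / ln (2 - t))"
      by (rule integral_cong) (use elim in \<open>auto simp: g_def\<close>)
    also have "\<dots> = integral {1 + e..2} (\<lambda>t. 1 / ln t) + integral {1 + e..2} (\<lambda>t. 1 / ln (2 - t))"
      by (intro integral_add integrable_continuous_real cont1 cont2 elim)
    finally show ?case by (simp add: refl)
  qed
  ultimately have "((\<lambda>e. integral {0..1 - e} (\<lambda>t. 1 / ln t) + integral {1 + e..2} (\<lambda>t. 1 / ln t))
      \<longlongrightarrow> integral {1..2} g) (at_right 0)"
    by (rule Lim_transform_eventually)
  then show ?thesis by blast
qed

text \<open>Moving the upper endpoint from 2 to x changes the truncated integrals by an amount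
  independent of e. The auxiliary point \<open>a\<close> lies below both endpoints, which treats x <
  2 and x > 2 alike.\<close>

lemma li_tendsto:
  fixes x :: real
  assumes "1 < x"
  shows "((\<lambda>e. integral {0..1 - e} (\<lambda>t. 1 / ln t) + integral {1 + e..x} (\<lambda>t. 1 / ln t))
      \<longlongrightarrow> li x) (at_right 0)"
proof -
  let ?f = "\<lambda>t::real. 1 / ln t"
  define a where "a = min x 2"
  have a: "1 < a" "a \<le> x" "a \<le> 2" using assms by (auto simp: a_def)
  obtain l where l: "((\<lambda>e. integral {0..1 - e} ?f + integral {1 + e..2} ?f) \<longlongrightarrow> l) (at_right 0)"
    using li_principal_value_converges_2 by blast
  have "((\<lambda>e. integral {0..1 - e} ?f + integral {1 + e..2} ?f - integral {a..2} ?f + integral {a..x} ?f)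
      \<longlongrightarrow> l - integral {a..2} ?f + integral {a..x} ?f) (at_right 0)"
    by (intro tendsto_intros l)
  moreover have "eventually (\<lambda>e. integral {0..1 - e} ?f + integral {1 + e..2} ?f - integral {a..2} ?f
      + integral {a..x} ?f = integral {0..1 - e} ?f + integral {1 + e..x} ?f) (at_right 0)"
  proof -
    have "eventually (\<lambda>e. e \<in> {0<..<a - 1}) (at_right (0::real))"
      using a by (intro eventually_at_right_real) auto
    then show ?thesis
    proof eventually_elim
      case (elim e)
      have "integral {1 + e..a} ?f + integral {a..b} ?f = integral {1 + e..b} ?f" if "a \<le> b" for b
        by (rule Henstock_Kurzweil_Integration.integral_combine)
          (use elim that in \<open>auto intro!: integrable_inverse_ln\<close>)
      from this[of 2] this[of x] a show ?case by simp
    qed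
  qed
  ultimately have "((\<lambda>e. integral {0..1 - e} ?f + integral {1 + e..x} ?f)
      \<longlongrightarrow> l - integral {a..2} ?f + integral {a..x} ?f) (at_right 0)"
    by (rule Lim_transform_eventually)
  then show ?thesis
    by (metis (no_types, lifting) li_def tendsto_Lim trivial_limit_at_right_real)
qed

section \<open>Calculus of \<open>li\<close> to the right of 1\<close>

lemma li_eq_add_integral:
  fixes a x :: real
  assumes "1 < a" "a \<le> x"
  shows "li x = li a + integral {a..x} (\<lambda>t. 1 / ln t)"
proof -
  let ?f = "\<lambda>t::real. 1 / ln t"
  have "((\<lambda>e. (integral {0..1 - e} ?f + integral {1 + e..a} ?f) + integral {a..x} ?f)
      \<longlongrightarrow> li a + integral {a..x} ?f) (at_right 0)"
    by (intro tendsto_intros li_tendsto assms)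
  moreover have "eventually (\<lambda>e. (integral {0..1 - e} ?f + integral {1 + e..a} ?f) + integral {a..x} ?f
      = integral {0..1 - e} ?f + integral {1 + e..x} ?f) (at_right 0)"
  proof -
    have "eventually (\<lambda>e. e \<in> {0<..<a - 1}) (at_right (0::real))"
      using assms by (intro eventually_at_right_real) auto
    then show ?thesis
    proof eventually_elim
      case (elim e)
      have "integral {1 + e..a} ?f + integral {a..x} ?f = integral {1 + e..x} ?f"
        by (rule Henstock_Kurzweil_Integration.integral_combine)
          (use elim assms in \<open>auto intro!: integrable_inverse_ln\<close>)
      then show ?case by simp
    qed
  qed
  ultimately have "((\<lambda>e. integral {0..1 - e} ?f + integral {1 + e..x} ?f)
      \<longlongrightarrow> li a + integral {a..x} ?f) (at_right 0)"
    by (rule Lim_transform_eventually)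
  with li_tendsto[of x] assms show ?thesis
    by (intro tendsto_unique[of "at_right (0::real)"]) auto
qed

lemma has_real_derivative_li:
  assumes "1 < x"
  shows "(li has_real_derivative 1 / ln x) (at x)"
proof -
  define a where "a = (1 + x) / 2"
  have a: "1 < a" "a < x" using assms by (auto simp: a_def)
  have "((\<lambda>y. integral {a..y} (\<lambda>t. 1 / ln t)) has_real_derivative 1 / ln x) (at x within {a..x + 1})"
    by (rule integral_has_real_derivative)
      (use a in \<open>auto intro!: continuous_on_subset[OF continuous_on_inverse_ln]\<close>)
  then have "((\<lambda>y. li a + integral {a..y} (\<lambda>t. 1 / ln t)) has_real_derivative 1 / ln x)
      (at x within {a..x + 1})"
    by (auto intro!: derivative_eq_intros)
  then have "((\<lambda>y. li a + integral {a..y} (\<lambda>t. 1 / ln t)) has_real_derivative 1 / ln x) (at x)"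
    using a by (simp add: at_within_Icc_at)
  moreover have "eventually (\<lambda>y. li a + integral {a..y} (\<lambda>t. 1 / ln t) = li y) (nhds x)"
    by (rule eventually_mono[OF eventually_nhds_in_open[of "{a<..}" x]])
      (use a li_eq_add_integral[of a, symmetric] in auto)
  ultimately show ?thesis
    by (rule DERIV_cong_ev[OF refl _ refl, THEN iffD1, rotated])
qed

lemma strict_mono_on_li: "strict_mono_on {1<..} li"
proof (rule strict_mono_onI)
  fix a b :: real assume "a \<in> {1<..}" "b \<in> {1<..}" "a < b"
  then show "li a < li b"
    by (intro DERIV_pos_imp_increasing[of a b li])
      (auto intro!: exI has_real_derivative_li)
qed

lemma continuous_on_li: "continuous_on {1<..} li"
  by (intro continuous_at_imp_continuous_on ballI DERIV_isCont[OF has_real_derivative_li]) auto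

text \<open>\<open>H\<close> is what K integrations by parts of exp u / u produce. Its derivative
  telescopes, so li (exp u) - H u has derivative K! exp u / u^(K+1), and L'Hospital compares it with
  exp u / u^(K+1). Only the denominator has to tend to infinity, so the constant of integration
  never appears.\<close>

lemma li_exp_expansion:
  "(\<lambda>u. li (exp u) * u / exp u - (\<Sum>k<K. fact k / u ^ k)) \<in> O(\<lambda>u::real. 1 / u ^ K)"
proof -
  define H where "H = (\<lambda>u::real. exp u * (\<Sum>k<K. fact k / u ^ Suc k))"
  \<comment> \<open>The derivative of exp u / u^(K+1); for positive u it vanishes only at u = K +
    1.\<close>
  define d where "d = (\<lambda>u::real. exp u * (1 / u ^ Suc K - Suc K / u ^ Suc (Suc K)))"
  have Hder: "(H has_real_derivative exp u * (1 / u - fact K / u ^ Suc K)) (at u)" if "u > 0" for u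
  proof -
    have "(\<Sum>k<K. fact k / u ^ Suc k) - (\<Sum>k<K. fact (Suc k) / u ^ Suc (Suc k))
        = 1 / u - fact K / u ^ Suc K"
      using that by (induction K) (auto simp: field_simps)
    moreover have "(H has_real_derivative exp u * (\<Sum>k<K. fact k / u ^ Suc k)
        - exp u * (\<Sum>k<K. fact (Suc k) / u ^ Suc (Suc k))) (at u)"
    proof -
      have "((\<lambda>u. fact k / u ^ Suc k) has_real_derivative - (fact (Suc k) / u ^ Suc (Suc k))) (at u)" for k
      proof -
        have "((\<lambda>u. u ^ Suc k) has_real_derivative real (Suc k) * u ^ k) (at u)"
          using DERIV_pow[of "Suc k" u] by simp
        from DERIV_divide[OF DERIV_const[of "fact k"] this] show ?thesis
          by (rule DERIV_cong) (use that in \<open>auto simp: field_simps\<close>)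
      qed
      then have "((\<lambda>u. \<Sum>k<K. fact k / u ^ Suc k) has_real_derivative
          (\<Sum>k<K. - (fact (Suc k) / u ^ Suc (Suc k)))) (at u)"
        by (intro DERIV_sum)
      from DERIV_mult[OF DERIV_exp[of u] this] show ?thesis
        unfolding H_def by (simp only: sum_negf mult_minus_left mult_minus_right mult.commute diff_conv_add_uminus)
    qed
    ultimately show ?thesis by (simp only: right_diff_distrib[symmetric])
  qed
  have "((\<lambda>u. (li (exp u) - H u) / (exp u / u ^ Suc K)) \<longlongrightarrow> fact K) at_top"
  proof (rule lhospital_at_top_at_top)
    show "filterlim (\<lambda>u::real. exp u / u ^ Suc K) at_top at_top" by real_asymp
    show "\<forall>\<^sub>F u in at_top. d u \<noteq> 0"
      using eventually_gt_at_top[of "real (Suc K)"]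
      by eventually_elim (simp add: d_def divide_simps)
    show "\<forall>\<^sub>F u in at_top. ((\<lambda>u. li (exp u) - H u) has_real_derivative
        exp u * (fact K / u ^ Suc K)) (at u)"
      using eventually_gt_at_top[of 0]
    proof eventually_elim
      case (elim u)
      have "((\<lambda>u. li (exp u)) has_real_derivative exp u / u) (at u)"
        by (rule DERIV_chain'[OF DERIV_exp has_real_derivative_li, THEN DERIV_cong]) (use elim in auto)
      from DERIV_diff[OF this Hder[OF elim]] show ?case by (simp add: algebra_simps)
    qed
    show "\<forall>\<^sub>F u in at_top. ((\<lambda>u. exp u / u ^ Suc K) has_real_derivative d u) (at u)"
      using eventually_gt_at_top[of 0]
    proof eventually_elim
      case (elim u)
      have "((\<lambda>u. u ^ Suc K) has_real_derivative real (Suc K) * u ^ K) (at u)"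
        using DERIV_pow[of "Suc K" u] by simp
      from DERIV_divide[OF DERIV_exp this] show ?case
        by (rule DERIV_cong) (use elim in \<open>auto simp: d_def field_simps\<close>)
    qed
    show "((\<lambda>u. exp u * (fact K / u ^ Suc K) / d u) \<longlongrightarrow> fact K) at_top"
    proof (rule Lim_transform_eventually)
      show "((\<lambda>u::real. fact K / (1 - Suc K / u)) \<longlongrightarrow> fact K) at_top" by real_asymp
      show "\<forall>\<^sub>F u in at_top. fact K / (1 - Suc K / u) = exp u * (fact K / u ^ Suc K) / d u"
        using eventually_gt_at_top[of "real (Suc K)"]
      proof eventually_elim
        case (elim u)
        have "d u = (exp u / u ^ Suc K) * (1 - Suc K / u)"
          by (simp add: d_def right_diff_distrib)
        moreover have "exp u * (fact K / u ^ Suc K) = (exp u / u ^ Suc K) * fact K"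
          by simp
        moreover have "exp u / u ^ Suc K \<noteq> 0"
          using elim by auto
        ultimately show ?case
          by (metis nonzero_mult_divide_mult_cancel_left)
      qed
    qed
  qed
  then have "(\<lambda>u. li (exp u) - H u) \<in> O(\<lambda>u. exp u / u ^ Suc K)"
    by (rule bigoI_tendsto) (auto simp: eventually_at_top_linorder intro!: exI[of _ 1])
  \<comment> \<open>Multiplying by u / exp u turns \<open>H\<close> into the sum of k! / u^k and
    lowers the error exponent to K.\<close>
  then have "(\<lambda>u. (li (exp u) - H u) * (u / exp u)) \<in> O(\<lambda>u. exp u / u ^ Suc K * (u / exp u))"
    by (intro landau_o.big.mult) auto
  also have "(\<lambda>u. exp u / u ^ Suc K * (u / exp u)) \<in> \<Theta>(\<lambda>u::real. 1 / u ^ K)"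
    by (intro bigthetaI_cong eventually_mono[OF eventually_gt_at_top[of 0]]) (auto simp: field_simps)
  finally show ?thesis
  proof (rule landau_o.big.in_cong[THEN iffD1, rotated])
    show "\<forall>\<^sub>F u in at_top. (li (exp u) - H u) * (u / exp u)
        = li (exp u) * u / exp u - (\<Sum>k<K. fact k / u ^ k)"
      using eventually_gt_at_top[of 0]
      by eventually_elim (auto simp: H_def field_simps sum_distrib_left intro!: sum.cong)
  qed
qed

lemma li_exp_ratio_tendsto: "((\<lambda>u. li (exp u) * u / exp u) \<longlongrightarrow> 1) at_top"
proof -
  have "(\<lambda>u::real. 1 / u) \<in> o(\<lambda>_. 1)" by real_asymp
  with li_exp_expansion[of 1] have "(\<lambda>u. li (exp u) * u / exp u - 1) \<in> o(\<lambda>_. 1)"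
    using landau_o.big_small_trans by fastforce
  then have "((\<lambda>u. li (exp u) * u / exp u - 1) \<longlongrightarrow> 0) at_top"
    by (auto dest: smalloD_tendsto)
  then show ?thesis by (rule LIM_zero_cancel)
qed

section \<open>Growth of \<open>li\<close> and existence of the inverse\<close>

lemma filterlim_li_at_top: "filterlim li at_top at_top"
proof -
  have "filterlim (\<lambda>u. li (exp u) * u / exp u * (exp u / u)) at_top at_top"
    by (rule filterlim_tendsto_pos_mult_at_top[OF li_exp_ratio_tendsto zero_less_one]) real_asymp
  moreover have "\<forall>\<^sub>F u in at_top. li (exp u) * u / exp u * (exp u / u) = li (exp u)"
    using eventually_gt_at_top[of 0] by eventually_elim simp
  ultimately have "filterlim (\<lambda>u. li (exp u)) at_top at_top"
    using filterlim_cong by fast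
  then have "filterlim (\<lambda>x. li (exp (ln x))) at_top at_top"
    using ln_at_top by (rule filterlim_compose)
  moreover have "\<forall>\<^sub>F x in at_top. li (exp (ln x)) = li x"
    using eventually_gt_at_top[of 0] by eventually_elim simp
  ultimately show ?thesis
    using filterlim_cong by fast
qed

text \<open>Large y suffice for an asymptotic statement. Restricting to y at least li 2 lets the
  intermediate value theorem run on an interval starting at 2, so the behaviour of \<open>li\<close>
  near 1 need not be studied.\<close>

lemma
  assumes "li 2 \<le> y"
  shows ali_gt_1: "1 < ali y" and li_ali: "li (ali y) = y"
proof -
  have "\<forall>\<^sub>F x in at_top. y \<le> li x \<and> 2 \<le> x"
    using filterlim_li_at_top eventually_ge_at_top[of 2]
    by (intro eventually_conj) (auto simp: filterlim_at_top)
  then obtain b where b: "y \<le> li b" "2 \<le> b"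
    by (auto dest: eventually_happens)
  have "\<exists>x\<ge>2. x \<le> b \<and> li x = y"
    by (rule IVT') (use assms b in \<open>auto intro!: continuous_on_subset[OF continuous_on_li]\<close>)
  then obtain x where "1 < x" "li x = y" by force
  then have "\<exists>!x. 1 < x \<and> li x = y"
    using strict_mono_on_imp_inj_on[OF strict_mono_on_li] by (auto simp: inj_on_def)
  then have "1 < ali y \<and> li (ali y) = y"
    unfolding ali_def by (rule theI')
  then show "1 < ali y" "li (ali y) = y" by auto
qed

lemma filterlim_ali_at_top: "filterlim ali at_top at_top"
proof -
  have "\<forall>\<^sub>F y in at_top. Z \<le> ali y" for Z
    \<comment> \<open>The maximum with 2 keeps the comparison point inside the domain of
      monotonicity.\<close>
    using eventually_ge_at_top[of "li 2"] eventually_gt_at_top[of "li (max Z 2)"]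
  proof eventually_elim
    case (elim y)
    show "Z \<le> ali y"
    proof (rule ccontr)
      assume "\<not> Z \<le> ali y"
      then have "li (ali y) < li (max Z 2)"
        using ali_gt_1[OF elim(1)] by (intro strict_mono_onD[OF strict_mono_on_li]) auto
      with elim li_ali[OF elim(1)] show False by simp
    qed
  qed
  then show ?thesis by (simp add: filterlim_at_top)
qed

section \<open>Expansions in powers of 1 / x with coefficients polynomial in ln x\<close>

text \<open>The degree bound makes the n-th term O((ln x / x)^n), so the error has the size allowed
  for the first omitted term. The coefficients form an infinite sequence so that a single
  \<open>P\<close> can serve all orders M.\<close>

definition log_expands :: "nat \<Rightarrow> (nat \<Rightarrow> real poly) \<Rightarrow> (real \<Rightarrow> real) \<Rightarrow> bool" where
  "log_expands M P f \<longleftrightarrow> (\<forall>n. degree (P n) \<le> n) \<and>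
     (\<lambda>x. f x - (\<Sum>n<M. poly (P n) (ln x) / x ^ n)) \<in> O(\<lambda>x. (ln x / x) ^ M)"

text \<open>Hiding the coefficients separately for each order frees the closure lemmas from tracking
  them; \<open>log_expandable_imp_log_expands\<close> recovers a common sequence.\<close>

definition log_expandable :: "nat \<Rightarrow> (real \<Rightarrow> real) \<Rightarrow> bool" where
  "log_expandable M f \<longleftrightarrow> (\<exists>P. log_expands M P f)"

lemma ln_over_self_power_bigo:
  assumes "m \<le> n"
  shows "(\<lambda>x::real. (ln x / x) ^ n) \<in> O(\<lambda>x. (ln x / x) ^ m)"
proof -
  have "\<forall>\<^sub>F x::real in at_top. 0 \<le> ln x / x \<and> ln x / x \<le> 1"
    by (intro eventually_conj) real_asymp+
  then have "\<forall>\<^sub>F x::real in at_top. norm ((ln x / x) ^ n) \<le> norm ((ln x / x) ^ m)"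
    by eventually_elim (simp add: power_decreasing[OF assms])
  then show ?thesis by (rule landau_o.big_mono)
qed

lemma poly_ln_over_power_bigo:
  assumes "degree p \<le> n"
  shows "(\<lambda>x::real. poly p (ln x) / x ^ n) \<in> O(\<lambda>x. (ln x / x) ^ n)"
proof -
  have "(\<lambda>x::real. coeff p i * ln x ^ i / x ^ n) \<in> O(\<lambda>x. (ln x / x) ^ n)"
    if "i \<in> {..degree p}" for i
  proof -
    have "\<forall>\<^sub>F x::real in at_top. 1 \<le> ln x \<and> 0 < x"
      by (intro eventually_conj) real_asymp+
    then have "\<forall>\<^sub>F x::real in at_top.
        norm (coeff p i * ln x ^ i / x ^ n) \<le> \<bar>coeff p i\<bar> * norm ((ln x / x) ^ n)"
    proof eventually_elim
      case (elim x)
      have "\<bar>ln x\<bar> ^ i \<le> \<bar>ln x\<bar> ^ n"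
        using elim that assms by (intro power_increasing) auto
      then show ?case using elim
        by (auto simp: abs_mult power_abs power_divide field_simps intro!: mult_left_mono)
    qed
    then show ?thesis by (rule bigoI)
  qed
  then have "(\<lambda>x::real. \<Sum>i\<le>degree p. coeff p i * ln x ^ i / x ^ n) \<in> O(\<lambda>x. (ln x / x) ^ n)"
    by (rule big_sum_in_bigo)
  then show ?thesis
    by (simp add: poly_altdef sum_divide_distrib)
qed

section \<open>Closure properties of expandability\<close>

lemma log_expandable_cong:
  assumes "\<forall>\<^sub>F x in at_top. f x = g x"
  shows "log_expandable M f \<longleftrightarrow> log_expandable M g"
proof -
  have "(\<lambda>x. f x - s x) \<in> O(h) \<longleftrightarrow> (\<lambda>x. g x - s x) \<in> O(h)" for s h :: "real \<Rightarrow> real"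
    by (rule landau_o.big.in_cong) (use assms in eventually_elim, simp)
  then show ?thesis
    by (simp add: log_expandable_def log_expands_def)
qed

text \<open>All coefficients zero. This starts the fixed point iteration and absorbs remainders of
  series.\<close>

lemma log_expandable_bigo:
  assumes "f \<in> O(\<lambda>x. (ln x / x) ^ M)"
  shows "log_expandable M f"
  using assms unfolding log_expandable_def log_expands_def by (intro exI[of _ "\<lambda>_. 0"]) simp

lemma log_expandable_const: "log_expandable M (\<lambda>_. c)"
proof -
  have "(\<Sum>n<M. poly (if n = 0 then [:c:] else 0) (ln x) / x ^ n) = (if M = 0 then 0 else c)" for x :: real
    by (induction M) auto
  then have "log_expands M (\<lambda>n. if n = 0 then [:c:] else 0) (\<lambda>_. c)"
    by (simp add: log_expands_def)
  then show ?thesis unfolding log_expandable_def by blast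
qed

lemma log_expandable_ln_over_self: "log_expandable M (\<lambda>x. ln x / x)"
proof -
  have "(\<Sum>n<M. poly (if n = 1 then [:0, 1:] else 0) (ln x) / x ^ n) = (if M \<le> 1 then 0 else ln x / x)"
    for x :: real
    by (induction M) (auto simp: le_Suc_eq)
  \<comment> \<open>For such M the sum stops before its only nonzero term, so the function itself
    must fit into the error.\<close>
  moreover have "(\<lambda>x::real. ln x / x) \<in> O(\<lambda>x. (ln x / x) ^ M)" if "M \<le> 1"
    using ln_over_self_power_bigo[OF that] by simp
  ultimately have "log_expands M (\<lambda>n. if n = 1 then [:0, 1:] else 0) (\<lambda>x. ln x / x)"
    by (cases "M \<le> 1") (simp_all add: log_expands_def)
  then show ?thesis unfolding log_expandable_def by blast
qed

lemma log_expandable_add: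
  assumes "log_expandable M f" "log_expandable M g"
  shows "log_expandable M (\<lambda>x. f x + g x)"
proof -
  from assms obtain P Q where PQ: "log_expands M P f" "log_expands M Q g"
    unfolding log_expandable_def by blast
  then have "log_expands M (\<lambda>n. P n + Q n) (\<lambda>x. f x + g x)"
    using sum_in_bigo(1)[of "\<lambda>x. f x - (\<Sum>n<M. poly (P n) (ln x) / x ^ n)" at_top
        "\<lambda>x. (ln x / x) ^ M" "\<lambda>x. g x - (\<Sum>n<M. poly (Q n) (ln x) / x ^ n)"]
    by (auto simp: log_expands_def degree_add_le add_divide_distrib sum.distrib algebra_simps)
  then show ?thesis unfolding log_expandable_def by blast
qed

text \<open>The source of the gain in order: the coefficients shift by one index, and 1 / x = O(ln x
  / x) improves the error by one power.\<close>

lemma log_expandable_over_self: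
  assumes "log_expandable M f"
  shows "log_expandable (Suc M) (\<lambda>x. f x / x)"
proof -
  from assms obtain P where P: "log_expands M P f"
    unfolding log_expandable_def by blast
  define Q where "Q = (\<lambda>n. case n of 0 \<Rightarrow> 0 | Suc m \<Rightarrow> P m)"
  have sumQ: "(\<Sum>n<Suc M. poly (Q n) (ln x) / x ^ n) = (\<Sum>n<M. poly (P n) (ln x) / x ^ n) / x" for x
    by (simp only: sum.lessThan_Suc_shift) (simp add: Q_def sum_divide_distrib mult.commute)
  have "(\<lambda>x. (f x - (\<Sum>n<M. poly (P n) (ln x) / x ^ n)) * (1 / x)) \<in> O(\<lambda>x. (ln x / x) ^ M * (ln x / x))"
  proof (rule landau_o.big.mult)
    show "(\<lambda>x::real. 1 / x) \<in> O(\<lambda>x. ln x / x)" by real_asymp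
  qed (use P in \<open>simp add: log_expands_def\<close>)
  then have "(\<lambda>x. f x / x - (\<Sum>n<Suc M. poly (Q n) (ln x) / x ^ n)) \<in> O(\<lambda>x. (ln x / x) ^ Suc M)"
    unfolding sumQ by (simp add: diff_divide_distrib mult.commute)
  moreover have "degree (Q n) \<le> n" for n
    using P by (auto simp: Q_def log_expands_def le_SucI split: nat.splits)
  ultimately show ?thesis
    unfolding log_expandable_def log_expands_def by blast
qed

text \<open>Cauchy product. With F, G the truncations of f, g, the error is (f - F) g + F (g - G)
  plus the products of terms of total order at least M, which \<open>T\<close> collects. The factors
  g and F are bounded, so each part is O((ln x / x)^M).\<close>

lemma log_expandable_mult:
  assumes "log_expandable M f" "log_expandable M g"
  shows "log_expandable M (\<lambda>x. f x * g x)"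
proof -
  from assms obtain P Q where P: "log_expands M P f" and Q: "log_expands M Q g"
    unfolding log_expandable_def by blast
  have deg: "degree (P n) \<le> n" "degree (Q n) \<le> n" for n
    using P Q by (auto simp: log_expands_def)
  define a where "a = (\<lambda>n x::real. poly (P n) (ln x) / x ^ n)"
  define b where "b = (\<lambda>n x::real. poly (Q n) (ln x) / x ^ n)"
  define R where "R = (\<lambda>n. \<Sum>i\<le>n. P i * Q (n - i))"
  have a: "a n \<in> O(\<lambda>x. (ln x / x) ^ n)" and b: "b n \<in> O(\<lambda>x. (ln x / x) ^ n)" for n
    using deg by (auto simp: a_def b_def intro: poly_ln_over_power_bigo)
  have F: "(\<lambda>x. \<Sum>n<M. a n x) \<in> O(\<lambda>_. 1)"
    using landau_o.big.trans[OF a ln_over_self_power_bigo[of 0]] by (intro big_sum_in_bigo) simp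
  have G: "(\<lambda>x. \<Sum>n<M. b n x) \<in> O(\<lambda>_. 1)"
    using landau_o.big.trans[OF b ln_over_self_power_bigo[of 0]] by (intro big_sum_in_bigo) simp
  have rf: "(\<lambda>x. f x - (\<Sum>n<M. a n x)) \<in> O(\<lambda>x. (ln x / x) ^ M)"
    and rg: "(\<lambda>x. g x - (\<Sum>n<M. b n x)) \<in> O(\<lambda>x. (ln x / x) ^ M)"
    using P Q by (auto simp: log_expands_def a_def b_def)
  have g: "g \<in> O(\<lambda>_. 1)"
    using sum_in_bigo(1)[OF landau_o.big.trans[OF rg ln_over_self_power_bigo[of 0]], of "\<lambda>x. \<Sum>n<M. b n x"] G
    by simp
  define T where "T = {(i, j). i < M \<and> j < M \<and> M \<le> i + j}"
  have split: "(\<Sum>i<M. a i x) * (\<Sum>j<M. b j x)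
      = (\<Sum>n<M. poly (R n) (ln x) / x ^ n) + (\<Sum>(i, j)\<in>T. a i x * b j x)" if "x > 0" for x
  proof -
    have "(\<Sum>n<M. poly (R n) (ln x) / x ^ n) = (\<Sum>n<M. \<Sum>i\<le>n. a i x * b (n - i) x)"
      by (auto simp: R_def poly_sum sum_divide_distrib a_def b_def power_add[symmetric] intro!: sum.cong)
    also have "\<dots> = (\<Sum>(i, j)\<in>{(i, j). i + j < M}. a i x * b j x)"
      by (rule sum.triangle_reindex[symmetric])
    finally have "(\<Sum>n<M. poly (R n) (ln x) / x ^ n) + (\<Sum>(i, j)\<in>T. a i x * b j x)
        = (\<Sum>(i, j)\<in>{(i, j). i + j < M} \<union> T. a i x * b j x)"
      by (subst sum.union_disjoint)
        (auto simp: T_def intro: finite_subset[of _ "{..<M} \<times> {..<M}"])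
    also have "{(i, j). i + j < M} \<union> T = {..<M} \<times> {..<M}"
      by (auto simp: T_def)
    finally show ?thesis
      by (simp add: sum_product sum.cartesian_product)
  qed
  have "(\<lambda>x. case p of (i, j) \<Rightarrow> a i x * b j x) \<in> O(\<lambda>x. (ln x / x) ^ M)" if "p \<in> T" for p
  proof -
    obtain i j where p: "p = (i, j)" by force
    have "(\<lambda>x. a i x * b j x) \<in> O(\<lambda>x. (ln x / x) ^ (i + j))"
      unfolding power_add by (intro landau_o.big.mult a b)
    also have "(\<lambda>x::real. (ln x / x) ^ (i + j)) \<in> O(\<lambda>x. (ln x / x) ^ M)"
      using that p by (intro ln_over_self_power_bigo) (auto simp: T_def)
    finally show ?thesis by (simp add: p)
  qed
  then have tail: "(\<lambda>x. \<Sum>(i, j)\<in>T. a i x * b j x) \<in> O(\<lambda>x. (ln x / x) ^ M)"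
    by (rule big_sum_in_bigo)
  have "(\<lambda>x. (f x - (\<Sum>n<M. a n x)) * g x + (\<Sum>n<M. a n x) * (g x - (\<Sum>n<M. b n x))
      + (\<Sum>(i, j)\<in>T. a i x * b j x)) \<in> O(\<lambda>x. (ln x / x) ^ M)"
    using landau_o.big.mult[OF rf g] landau_o.big.mult[OF F rg]
    by (intro sum_in_bigo(1) tail) simp_all
  also have "?this \<longleftrightarrow> (\<lambda>x. f x * g x - (\<Sum>n<M. poly (R n) (ln x) / x ^ n)) \<in> O(\<lambda>x. (ln x / x) ^ M)"
  proof (rule landau_o.big.in_cong)
    show "\<forall>\<^sub>F x in at_top. (f x - (\<Sum>n<M. a n x)) * g x + (\<Sum>n<M. a n x) * (g x - (\<Sum>n<M. b n x))
      + (\<Sum>(i, j)\<in>T. a i x * b j x) = f x * g x - (\<Sum>n<M. poly (R n) (ln x) / x ^ n)"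
      using eventually_gt_at_top[of 0]
    proof eventually_elim
      case (elim x)
      from split[OF this] show ?case by (simp add: algebra_simps)
    qed
  qed
  finally have "(\<lambda>x. f x * g x - (\<Sum>n<M. poly (R n) (ln x) / x ^ n)) \<in> O(\<lambda>x. (ln x / x) ^ M)" .
  moreover have "degree (R n) \<le> n" for n
    unfolding R_def
  proof (rule degree_sum_le)
    fix i assume "i \<in> {..n}"
    then show "degree (P i * Q (n - i)) \<le> n"
      using degree_mult_le[of "P i" "Q (n - i)"] deg(1)[of i] deg(2)[of "n - i"] by simp
  qed simp
  ultimately show ?thesis
    unfolding log_expandable_def log_expands_def by blast
qed

lemma log_expandable_power:
  "log_expandable M f \<Longrightarrow> log_expandable M (\<lambda>x. f x ^ k)"
  by (induction k) (simp_all add: log_expandable_const log_expandable_mult)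

lemma log_expandable_sum:
  assumes "\<And>k. k \<in> A \<Longrightarrow> log_expandable M (f k)"
  shows "log_expandable M (\<lambda>x. \<Sum>k\<in>A. f k x)"
  using assms
  by (induction A rule: infinite_finite_induct)
    (simp_all add: log_expandable_const log_expandable_add)

text \<open>Only an estimate at the one order M is assumed, not convergence, so the divergent series
  of A is covered. The bound on z turns z^M into an admissible error.\<close>

lemma log_expandable_asymp_series:
  assumes g: "(\<lambda>x. g (z x) - (\<Sum>k<M. c k * z x ^ k)) \<in> O(\<lambda>x. z x ^ M)"
    and z: "log_expandable M z" "z \<in> O(\<lambda>x. ln x / x)"
  shows "log_expandable M (\<lambda>x. g (z x))"
proof -
  have "log_expandable M (\<lambda>x. (\<Sum>k<M. c k * z x ^ k) + (g (z x) - (\<Sum>k<M. c k * z x ^ k)))"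
    by (intro log_expandable_add log_expandable_sum log_expandable_mult log_expandable_const
        log_expandable_power z log_expandable_bigo landau_o.big.trans[OF g] landau_o.big_power)
  then show ?thesis by simp
qed

text \<open>The remainder is z^M times the power series with coefficients shifted by M, which is
  continuous at 0 and hence bounded along z.\<close>

lemma sums_remainder_bigo:
  fixes g :: "real \<Rightarrow> real"
  assumes g: "\<And>z. \<bar>z\<bar> < 1 \<Longrightarrow> (\<lambda>k. c k * z ^ k) sums g z" and z: "(z \<longlongrightarrow> 0) F"
  shows "(\<lambda>x. g (z x) - (\<Sum>k<M. c k * z x ^ k)) \<in> O[F](\<lambda>x. z x ^ M)"
proof -
  have "summable (\<lambda>k. c (k + M) * (1 / 2) ^ k)"
  proof -
    have "summable (\<lambda>k. c (k + M) * (1 / 2) ^ (k + M) * 2 ^ M)"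
      using g[of "1 / 2"] by (intro summable_mult2 summable_ignore_initial_segment) (auto simp: sums_iff)
    then show ?thesis by (simp add: power_add power_divide)
  qed
  then have "isCont (\<lambda>z::real. \<Sum>k. c (k + M) * z ^ k) 0"
    by (rule isCont_powser) simp
  from isCont_tendsto_compose[OF this z]
  have "(\<lambda>x. \<Sum>k. c (k + M) * z x ^ k) \<in> O[F](\<lambda>_. 1)"
    by (intro bigoI_tendsto[where c = "\<Sum>k. c (k + M) * 0 ^ k"]) auto
  then have "(\<lambda>x. z x ^ M * (\<Sum>k. c (k + M) * z x ^ k)) \<in> O[F](\<lambda>x. z x ^ M * 1)"
    by (intro landau_o.big.mult) auto
  also have "?this \<longleftrightarrow> (\<lambda>x. g (z x) - (\<Sum>k<M. c k * z x ^ k)) \<in> O[F](\<lambda>x. z x ^ M * 1)"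
  proof (rule landau_o.big.in_cong)
    have "\<forall>\<^sub>F x in F. \<bar>z x\<bar> < 1"
      using order_tendstoD(2)[OF tendsto_rabs[OF z], of 1] by simp
    then show "\<forall>\<^sub>F x in F. z x ^ M * (\<Sum>k. c (k + M) * z x ^ k) = g (z x) - (\<Sum>k<M. c k * z x ^ k)"
    proof eventually_elim
      case (elim x)
      from sums_split_initial_segment[OF g[OF elim], of M]
      have *: "(\<lambda>k. z x ^ M * (c (k + M) * z x ^ k)) sums (g (z x) - (\<Sum>k<M. c k * z x ^ k))"
        by (simp add: power_add algebra_simps)
      show ?case
      \<comment> \<open>Summability of the shifted series comes from cancelling z^M, which is
        impossible at 0; there the shifted series is just its constant term.\<close>
      proof (cases "z x = 0")
        case True
        have "(\<Sum>k. c (k + M) * z x ^ k) = c M"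
          using powser_zero[of "\<lambda>k. c (k + M)"] True by simp
        then show ?thesis using * sums_unique[OF *] True by (cases M) auto
      next
        case False
        then have "summable (\<lambda>k. c (k + M) * z x ^ k)"
          using sums_summable[OF *] by (simp add: summable_cmult_iff)
        from suminf_mult[OF this, of "z x ^ M"] show ?thesis
          using sums_unique[OF *] by simp
      qed
    qed
  qed
  finally show ?thesis by simp
qed

lemma log_expandable_powser:
  assumes "\<And>z. \<bar>z\<bar> < 1 \<Longrightarrow> (\<lambda>k. c k * z ^ k) sums g z"
    and "log_expandable M z" "z \<in> O(\<lambda>x. ln x / x)"
  shows "log_expandable M (\<lambda>x. g (z x))"
proof -
  have "((\<lambda>x::real. ln x / x) \<longlongrightarrow> 0) at_top" by real_asymp
  then have "z \<in> o(\<lambda>_. 1)"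
    using assms(3) by (intro landau_o.big_small_trans[OF assms(3)] smalloI_tendsto) auto
  then have "(z \<longlongrightarrow> 0) at_top"
    by (auto dest: smalloD_tendsto)
  from sums_remainder_bigo[where g = g and c = c, OF assms(1) this]
  show ?thesis
    using assms(2,3) by (rule log_expandable_asymp_series)
qed

lemma log_expandable_ln:
  assumes "log_expandable M f" "(\<lambda>x. f x - 1) \<in> O(\<lambda>x. ln x / x)"
  shows "log_expandable M (\<lambda>x. ln (f x))"
proof -
  \<comment> \<open>The coefficient at k = 0 is a division by zero, hence 0, as the logarithm series
    requires.\<close>
  have "(\<lambda>k. (- ((- 1) ^ k) / real k) * z ^ k) sums ln (1 + z)" if "\<bar>z\<bar> < 1" for z :: real
    using ln_series'[OF that] by (simp add: power_minus[of z] algebra_simps)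
  moreover have "log_expandable M (\<lambda>x. f x - 1)"
    using log_expandable_add[OF assms(1) log_expandable_const[of M "-1"]] by simp
  ultimately have "log_expandable M (\<lambda>x. ln (1 + (f x - 1)))"
    using assms(2) by (rule log_expandable_powser)
  then show ?thesis by simp
qed

lemma log_expandable_inverse:
  assumes "log_expandable M f" "(\<lambda>x. f x - 1) \<in> O(\<lambda>x. ln x / x)"
  shows "log_expandable M (\<lambda>x. 1 / f x)"
proof -
  have "(\<lambda>k. (- 1) ^ k * z ^ k) sums (1 / (1 + z))" if "\<bar>z\<bar> < 1" for z :: real
    using geometric_sums[of "-z"] that by (simp add: power_minus[of z])
  moreover have "log_expandable M (\<lambda>x. f x - 1)"
    using log_expandable_add[OF assms(1) log_expandable_const[of M "-1"]] by simp
  ultimately have "log_expandable M (\<lambda>x. 1 / (1 + (f x - 1)))"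
    using assms(2) by (rule log_expandable_powser)
  then show ?thesis by simp
qed

section \<open>Uniqueness of coefficients and compatibility of orders\<close>

lemma log_expands_Suc_D:
  assumes "log_expands (Suc M) P f"
  shows "log_expands M P f"
proof -
  have deg: "degree (P n) \<le> n" for n using assms by (simp add: log_expands_def)
  have "(\<lambda>x. (f x - (\<Sum>n<Suc M. poly (P n) (ln x) / x ^ n)) + poly (P M) (ln x) / x ^ M)
      \<in> O(\<lambda>x. (ln x / x) ^ M)"
    using assms unfolding log_expands_def
    by (intro sum_in_bigo(1) poly_ln_over_power_bigo[OF deg]
        landau_o.big.trans[OF _ ln_over_self_power_bigo[of M "Suc M"]]) auto
  then show ?thesis using deg by (simp add: log_expands_def)
qed

lemma log_expandable_Suc_D: "log_expandable (Suc M) f \<Longrightarrow> log_expandable M f"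
  unfolding log_expandable_def using log_expands_Suc_D by blast

lemma poly_tendsto_zero_imp_zero:
  fixes p :: "real poly"
  assumes "(poly p \<longlongrightarrow> 0) at_top"
  shows "p = 0"
proof (cases "degree p = 0")
  case True
  then obtain c where "p = [:c:]" by (rule degree_eq_zeroE)
  then have "poly p = (\<lambda>_. c)" by auto
  with assms have "c = 0" by (simp add: tendsto_const_iff)
  with \<open>p = [:c:]\<close> show ?thesis by simp
next
  case False
  then have "filterlim (poly p) at_infinity at_top"
    by (intro filterlim_mono[OF filterlim_poly_at_infinity]) (auto simp: at_top_le_at_infinity)
  with assms show ?thesis
    using not_tendsto_and_filterlim_at_infinity[of at_top "poly p" 0] by simp
qed

text \<open>If all lower coefficients agree, subtracting leaves p (ln x) / x^M = O((ln x /
  x)^(M+1)). Under x = exp y this reads p y = O(y^(M+1) / exp y), which tends to 0 and forces p =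
  0.\<close>

lemma log_expands_unique:
  assumes "log_expands M P f" "log_expands M Q f"
  shows "n < M \<Longrightarrow> P n = Q n"
  using assms
proof (induction M arbitrary: n)
  case 0
  then show ?case by simp
next
  case (Suc M)
  have less: "P m = Q m" if "m < M" for m
    using Suc.IH[OF that] Suc.prems log_expands_Suc_D by blast
  define p where "p = Q M - P M"
  have "(\<lambda>x. (f x - (\<Sum>n<Suc M. poly (P n) (ln x) / x ^ n))
      - (f x - (\<Sum>n<Suc M. poly (Q n) (ln x) / x ^ n))) \<in> O(\<lambda>x. (ln x / x) ^ Suc M)"
    using Suc.prems(2,3) unfolding log_expands_def by (elim conjE) (rule sum_in_bigo(2))
  then have "(\<lambda>x. poly p (ln x) / x ^ M) \<in> O(\<lambda>x. (ln x / x) ^ Suc M)"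
    by (simp add: p_def less diff_divide_distrib)
  from landau_o.big.compose[OF this exp_at_top]
  have "(\<lambda>y. poly p y / exp y ^ M) \<in> O(\<lambda>y. (y / exp y) ^ Suc M)"
    by simp
  from landau_o.big.mult[OF this landau_o.big_refl[of "\<lambda>y. exp y ^ M"]]
  have "poly p \<in> O(\<lambda>y. y ^ Suc M / exp y)"
    by (simp add: power_divide)
  moreover have "(\<lambda>y::real. y ^ Suc M / exp y) \<in> o(\<lambda>_. 1)"
    by real_asymp
  ultimately have "poly p \<in> o(\<lambda>_. 1)"
    by (rule landau_o.big_small_trans)
  then have "(poly p \<longlongrightarrow> 0) at_top"
    by (auto dest: smalloD_tendsto)
  then have "p = 0" by (rule poly_tendsto_zero_imp_zero)
  with Suc.prems(1) less show ?case
    by (auto simp: p_def less_Suc_eq)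
qed

lemma log_expandable_imp_log_expands:
  assumes "\<And>M. log_expandable M f"
  obtains P where "\<And>M. log_expands M P f"
proof -
  obtain Q where Q: "\<And>M. log_expands M (Q M) f"
    using assms unfolding log_expandable_def by metis
  have *: "Q M n = Q (Suc n) n" if "n < M" for M n
    using that
  proof (induction M)
    case (Suc M)
    show ?case
    proof (cases "n = M")
      case False
      with Suc.prems have "n < M" by simp
      then show ?thesis
        using Suc.IH log_expands_unique[OF log_expands_Suc_D[OF Q[of "Suc M"]] Q[of M]] by simp
    qed simp
  qed simp
  \<comment> \<open>Diagonal choice: order n + 1 is the first that determines the n-th coefficient,
    and all higher orders agree with it.\<close>
  have "log_expands M (\<lambda>n. Q (Suc n) n) f" for M
  proof -
    have "(\<Sum>n<M. poly (Q (Suc n) n) (ln x) / x ^ n) = (\<Sum>n<M. poly (Q M n) (ln x) / x ^ n)" for x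
      by (intro sum.cong refl) (simp add: *[of _ M])
    then show ?thesis
      using Q by (auto simp: log_expands_def)
  qed
  then show thesis by (rule that)
qed

text \<open>At order 1 the degree bound makes the coefficient constant and the error ln x / x
  vanishes in the limit. It supplies the leading 1 of the theorem.\<close>

lemma log_expands_leading_coeff:
  assumes "log_expands (Suc M) P f" "(f \<longlongrightarrow> c) at_top"
  shows "P 0 = [:c:]"
proof -
  have "log_expands (Suc M') P f \<Longrightarrow> log_expands 1 P f" for M'
    by (induction M') (auto dest: log_expands_Suc_D)
  with assms(1) have P: "log_expands 1 P f" by blast
  then have "degree (P 0) = 0"
    by (auto simp: log_expands_def)
  then obtain d where d: "P 0 = [:d:]" by (rule degree_eq_zeroE)
  have "(\<lambda>x::real. ln x / x) \<in> o(\<lambda>_. 1)" by real_asymp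
  then have "(\<lambda>x. f x - d) \<in> o(\<lambda>_. 1)"
    using P d landau_o.big_small_trans by (fastforce simp: log_expands_def)
  then have "((\<lambda>x. f x - d) \<longlongrightarrow> 0) at_top"
    by (auto dest: smalloD_tendsto)
  then have "(f \<longlongrightarrow> d) at_top" by (rule LIM_zero_cancel)
  with assms(2) have "d = c" by (intro tendsto_unique[of at_top f]) auto
  with d show ?thesis by simp
qed

section \<open>Expansion of the inverse logarithmic integral\<close>

lemma ali_exp_log_expandable:
  defines "v \<equiv> \<lambda>x. ali (exp x) / (x * exp x)"
  shows "log_expandable M v" and "(v \<longlongrightarrow> 1) at_top"
proof -
  define u where "u = (\<lambda>x. ln (ali (exp x)))"
  define A where "A = (\<lambda>u. li (exp u) * u / exp u)"
  define w where "w = (\<lambda>x. u x - x - ln x)"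
  have A_lim: "(A \<longlongrightarrow> 1) at_top"
    unfolding A_def by (rule li_exp_ratio_tendsto)
  have u_top: "filterlim u at_top at_top"
    unfolding u_def
    by (intro filterlim_compose[OF ln_at_top] filterlim_compose[OF filterlim_ali_at_top] exp_at_top)
  have u_pos: "\<forall>\<^sub>F x in at_top. u x > 0"
    using u_top by (auto simp: filterlim_at_top_dense)
  have Au_lim: "((\<lambda>x. A (u x)) \<longlongrightarrow> 1) at_top"
    using A_lim u_top by (rule filterlim_compose)
  have exp_u: "\<forall>\<^sub>F x in at_top. exp (u x) = ali (exp x) \<and> li (exp (u x)) = exp x"
  proof -
    have "\<forall>\<^sub>F x in at_top. li 2 \<le> exp x"
      using exp_at_top by (auto simp: filterlim_at_top)
    then show ?thesis
    proof eventually_elim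
      case (elim x)
      then show ?case using ali_gt_1[OF elim] li_ali[OF elim] by (simp add: u_def)
    qed
  qed
  have Au: "\<forall>\<^sub>F x in at_top. A (u x) = exp x * u x / exp (u x)"
    using exp_u unfolding A_def by eventually_elim metis
  have ln_Au: "\<forall>\<^sub>F x in at_top. ln (A (u x)) = x + ln (u x) - u x"
    using Au u_pos by eventually_elim (simp add: ln_div ln_mult)
  have y_lim: "((\<lambda>x. u x / x) \<longlongrightarrow> 1) at_top"
  proof -
    \<comment> \<open>Dividing ln A(u) = x + ln u - u by u expresses x / u through u alone, so its
      limit follows from that of u.\<close>
    have "((\<lambda>t. 1 - ln t / t + ln (A t) * (1 / t)) \<longlongrightarrow> 1 - 0 + ln 1 * 0) at_top"
      by (intro tendsto_intros A_lim) (real_asymp | simp)+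
    then have "((\<lambda>x. 1 - ln (u x) / u x + ln (A (u x)) * (1 / u x)) \<longlongrightarrow> 1) at_top"
      using filterlim_compose[OF _ u_top] by fastforce
    moreover have "\<forall>\<^sub>F x in at_top. 1 - ln (u x) / u x + ln (A (u x)) * (1 / u x) = x / u x"
      using ln_Au u_pos by eventually_elim (simp add: field_simps)
    ultimately have "((\<lambda>x. x / u x) \<longlongrightarrow> 1) at_top"
      by (rule Lim_transform_eventually)
    from tendsto_inverse[OF this] show ?thesis by simp
  qed
  have w_eq: "\<forall>\<^sub>F x in at_top. ln (u x / x) + (-1) * ln (A (u x)) = w x"
    using ln_Au u_pos eventually_gt_at_top[of 0]
    by eventually_elim (simp add: w_def ln_div)
  have "((\<lambda>x. ln (u x / x) + (-1) * ln (A (u x))) \<longlongrightarrow> ln 1 + (-1) * ln 1) at_top"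
    by (intro tendsto_intros y_lim Au_lim) auto
  then have "(w \<longlongrightarrow> 0) at_top"
    using w_eq by (auto intro: Lim_transform_eventually)
  then have w_bigo: "w \<in> O(\<lambda>_. 1)"
    by (intro bigoI_tendsto[where c = 0]) auto
  have inv_bigo: "(\<lambda>x::real. 1 / x) \<in> O(\<lambda>x. ln x / x)" by real_asymp
  have y_eq: "\<forall>\<^sub>F x in at_top. 1 + (ln x / x + w x / x) = u x / x"
    using eventually_gt_at_top[of 0] by eventually_elim (simp add: w_def field_simps)
  have y_bigo: "(\<lambda>x. u x / x - 1) \<in> O(\<lambda>x. ln x / x)"
  proof -
    have "(\<lambda>x. ln x / x + w x * (1 / x)) \<in> O(\<lambda>x. ln x / x)"
      using landau_o.big.mult[OF w_bigo inv_bigo] by (intro sum_in_bigo) auto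
    also have "?this \<longleftrightarrow> ?thesis"
      by (rule landau_o.big.in_cong) (use y_eq in eventually_elim, simp)
    finally show ?thesis .
  qed
  have inv_u_eq: "\<forall>\<^sub>F x in at_top. 1 / x * (1 / (u x / x)) = 1 / u x"
    using u_pos eventually_gt_at_top[of 0] by eventually_elim simp
  have inv_u_bigo: "(\<lambda>x. 1 / u x) \<in> O(\<lambda>x. ln x / x)"
  proof -
    have "((\<lambda>x. 1 / (u x / x)) \<longlongrightarrow> 1 / 1) at_top"
      by (intro tendsto_intros y_lim) auto
    then have "(\<lambda>x. 1 / (u x / x)) \<in> O(\<lambda>_. 1)"
      by (intro bigoI_tendsto[where c = 1]) auto
    from landau_o.big.mult[OF inv_bigo this]
    have "(\<lambda>x. 1 / x * (1 / (u x / x))) \<in> O(\<lambda>x. ln x / x)" by simp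
    also have "?this \<longleftrightarrow> ?thesis"
      by (rule landau_o.big.in_cong[OF inv_u_eq])
    finally show ?thesis .
  qed
  have Au_expansion: "(\<lambda>x. A (u x) - (\<Sum>k<K. fact k * (1 / u x) ^ k)) \<in> O(\<lambda>x. (1 / u x) ^ K)" for K
    using landau_o.big.compose[OF li_exp_expansion[of K] u_top]
    by (simp add: A_def power_divide)
  have Au_bigo: "(\<lambda>x. A (u x) - 1) \<in> O(\<lambda>x. ln x / x)"
    using landau_o.big.trans[OF Au_expansion[of 1], of "\<lambda>x. ln x / x"] inv_u_bigo by simp
  \<comment> \<open>Dividing w by x gains one order, so an expansion of w to order M gives one of u / x,
    of A (u x), and hence of w itself, to order M + 1.\<close>
  have step_y: "log_expandable (Suc M) (\<lambda>x. u x / x)" if "log_expandable M w" for M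
  proof -
    have "log_expandable (Suc M) (\<lambda>x. 1 + (ln x / x + w x / x))"
      by (intro log_expandable_add log_expandable_const log_expandable_ln_over_self
          log_expandable_over_self that)
    then show ?thesis by (simp only: log_expandable_cong[OF y_eq])
  qed
  have step_A: "log_expandable (Suc M) (\<lambda>x. A (u x))" if "log_expandable M w" for M
  proof -
    have "log_expandable (Suc M) (\<lambda>x. 1 / x * (1 / (u x / x)))"
      by (intro log_expandable_mult[OF log_expandable_over_self[OF log_expandable_const]
            log_expandable_inverse[OF step_y[OF that] y_bigo]])
    then have z: "log_expandable (Suc M) (\<lambda>x. 1 / u x)"
      by (simp only: log_expandable_cong[OF inv_u_eq])
    \<comment> \<open>The small quantity to substitute is 1 / u, so A is read as a function of the
      reciprocal of its argument.\<close>
    have "log_expandable (Suc M) (\<lambda>x. (\<lambda>t. A (1 / t)) (1 / u x))"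
      by (rule log_expandable_asymp_series[where c = fact, OF _ z inv_u_bigo])
        (use Au_expansion[of "Suc M"] in simp)
    then show ?thesis by simp
  qed
  have w_exp: "log_expandable M w" for M
  proof (induction M)
    case 0
    \<comment> \<open>An expansion of order 0 is just boundedness.\<close>
    then show ?case using w_bigo by (intro log_expandable_bigo) simp
  next
    case (Suc M)
    have "log_expandable (Suc M) (\<lambda>x. ln (u x / x) + (-1) * ln (A (u x)))"
      by (rule log_expandable_add[OF log_expandable_ln[OF step_y[OF Suc] y_bigo]
            log_expandable_mult[OF log_expandable_const log_expandable_ln[OF step_A[OF Suc] Au_bigo]]])
    then show ?case by (simp only: log_expandable_cong[OF w_eq])
  qed
  \<comment> \<open>Since A(u) = exp x * u / exp u, the factor u cancels and exp u / (x exp x)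
    remains.\<close>
  have v_eq: "\<forall>\<^sub>F x in at_top. u x / x * (1 / A (u x)) = v x"
    using Au exp_u u_pos eventually_gt_at_top[of 0]
    by eventually_elim (simp add: v_def)
  have "log_expandable (Suc M) (\<lambda>x. u x / x * (1 / A (u x)))"
    by (rule log_expandable_mult[OF step_y[OF w_exp]
          log_expandable_inverse[OF step_A[OF w_exp] Au_bigo]])
  then show "log_expandable M v"
    using log_expandable_cong[OF v_eq] log_expandable_Suc_D by blast
  have "((\<lambda>x. u x / x * (1 / A (u x))) \<longlongrightarrow> 1 * (1 / 1)) at_top"
    by (intro tendsto_intros y_lim Au_lim) auto
  then show "(v \<longlongrightarrow> 1) at_top"
    using v_eq by (auto intro: Lim_transform_eventually)
qed

theorem theorem3p1:
  shows "\<exists>P :: nat \<Rightarrow> real poly.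
           (\<forall>m. degree (P m) \<le> m + 1) \<and>
           (\<forall>N::nat. (\<lambda>x. ali (exp x) / (x * exp x) - 1
                         - (\<Sum>n = 1..N. poly (P (n - 1)) (ln x) / x ^ n))
                    \<in> O[at_top](\<lambda>x::real. ln x ^ (N + 1) / x ^ (N + 1)))"
proof -
  obtain Q where Q: "\<And>M. log_expands M Q (\<lambda>x. ali (exp x) / (x * exp x))"
    using log_expandable_imp_log_expands[OF ali_exp_log_expandable(1)] by blast
  have Q0: "Q 0 = [:1:]"
    using log_expands_leading_coeff[OF Q ali_exp_log_expandable(2)] .
  show ?thesis
  \<comment> \<open>The constant term \<open>Q 0\<close> becomes the separate 1, and the index shift
    turns the bound n into m + 1. Order \<open>Suc N\<close> then yields the N remaining terms and
    the error exponent N + 1.\<close>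
  proof (intro exI[of _ "\<lambda>m. Q (Suc m)"] conjI allI)
    show "degree (Q (Suc m)) \<le> m + 1" for m
      using Q[of 0] by (simp add: log_expands_def)
  next
    fix N :: nat
    have "(\<Sum>n<Suc N. poly (Q n) (ln x) / x ^ n) = 1 + (\<Sum>n = 1..N. poly (Q (Suc (n - 1))) (ln x) / x ^ n)"
      for x
      by (simp only: sum.lessThan_Suc_shift) (simp add: Q0 sum.atLeast1_atMost_eq)
    with Q[of "Suc N"]
    show "(\<lambda>x. ali (exp x) / (x * exp x) - 1 - (\<Sum>n = 1..N. poly (Q (Suc (n - 1))) (ln x) / x ^ n))
        \<in> O(\<lambda>x. ln x ^ (N + 1) / x ^ (N + 1))"
      by (simp only: log_expands_def diff_diff_eq power_divide Suc_eq_plus1)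
  qed
qed

end
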